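(* Let $M$ be a compact $3$-manifold with triangulation $\mathcal{T}$ having $m$ edges. If the solution $l(t)$ of the flow $\dot{l}(t)=-R(l(t))$ in the space $\mathfrak{M}_l$ of nondegenerate PL-metrics exists for all time $t\ge 0$ and converges as $t\to+\infty$ to a nondegenerate PL-metric $l_\infty\in\mathfrak{M}_l$, then a discrete Ricci flat metric exists on $(M,\mathcal{T})$; moreover, $l_\infty$ is itself a discrete Ricci flat metric, i.e. $R(l_\infty)=0$.
   Context: Let $\mathcal{T}=\{V,E,F,T\}$ be a triangulation (vertices, edges, faces, tetrahedra) of a compact $3$-manifold $M$, with $m=|E|$. A PL-metric is a map $l:E\to(0,+\infty)$ such that, for every tetrahedron $\{i,j,k,l\}\in T$, its six edge lengths are realized by a Euclidean tetrahedron. It is nondegenerate if, for every tetrahedron, all edge lengths are positive, the Euclidean volume (given by the Cayley–Menger formula in the edge lengths) is positive, i.e. the Cayley–Menger determinant is positive, and the triangle inequalities hold in each face. The set of nondegenerate PL-metrics is denoted $\mathfrak{M}_l$ and is an open subset of $\mathbb{R}^m_{>0}$; a metric is written as a column vector $l=(l_1,\dots,l_m)^T$ after ordering the edges. The combinatorial Ricci curvature at an edge $\{i,j\}$ is $R_{ij}=2\pi-\sum_{\{i,j,k,l\}\in T}\beta_{ij,kl}$, where the sum is over all tetrahedra containing $\{i,j\}$ and $\beta_{ij,kl}$ is the dihedral angle of the Euclidean tetrahedron $\{i,j,k,l\}$ at the edge $\{i,j\}$; write $R=R(l)=(R_1,\dots,R_m)^T$ with the same ordering. A metric $l\in\mathfrak{M}_l$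 is discrete Ricci flat if $R(l)=0$. *)

theory Defs
  imports "HOL-Analysis.Analysis"
begin

section \<open>Triangulated compact 3-manifolds\<close>

text \<open>Charts are modelled on open subsets of a closed half-space of \<open>\<real>\<^sup>3\<close>, so that a possibly
  empty boundary is allowed; second countability follows from compactness.\<close>

definition compact_3manifold :: "'a topology \<Rightarrow> bool" where
  "compact_3manifold M \<longleftrightarrow>
     compact_space M \<and> Hausdorff_space M \<and>
     (\<forall>x\<in>topspace M. \<exists>U W. openin M U \<and> x \<in> U \<and>
        openin (top_of_set {y::real^3. 0 \<le> y $ 1}) W \<and>
        subtopology M U homeomorphic_space top_of_set W)"

text \<open>A simplex is represented by its vertex set.\<close>

definition simplices :: "'v set \<Rightarrow> 'v set set \<Rightarrow> 'v set set \<Rightarrow> 'v set set \<Rightarrow> 'v set set" where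
  "simplices V E F T = (\<lambda>v. {v}) ` V \<union> E \<union> F \<union> T"

definition simplicial_3complex :: "'v set \<Rightarrow> 'v set set \<Rightarrow> 'v set set \<Rightarrow> 'v set set \<Rightarrow> bool" where
  "simplicial_3complex V E F T \<longleftrightarrow>
     finite V \<and>
     (\<forall>e\<in>E. e \<subseteq> V \<and> card e = 2) \<and>
     (\<forall>f\<in>F. f \<subseteq> V \<and> card f = 3) \<and>
     (\<forall>\<sigma>\<in>T. \<sigma> \<subseteq> V \<and> card \<sigma> = 4) \<and>
     (\<forall>s\<in>simplices V E F T. \<forall>s'. s' \<subseteq> s \<and> s' \<noteq> {} \<longrightarrow> s' \<in> simplices V E F T)"

text \<open>Geometric realization in barycentric coordinates.\<close>

definition geometric_realization ::
  "'v set \<Rightarrow> 'v set set \<Rightarrow> 'v set set \<Rightarrow> 'v set set \<Rightarrow> ('v \<Rightarrow> real) topology" where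
  "geometric_realization V E F T =
     subtopology (product_topology (\<lambda>_. euclideanreal) V)
       {x. (\<forall>v\<in>V. 0 \<le> x v) \<and> (\<Sum>v\<in>V. x v) = 1 \<and> {v\<in>V. x v \<noteq> 0} \<in> simplices V E F T}"

definition triangulation_of ::
  "'a topology \<Rightarrow> 'v set \<Rightarrow> 'v set set \<Rightarrow> 'v set set \<Rightarrow> 'v set set \<Rightarrow> bool" where
  "triangulation_of M V E F T \<longleftrightarrow>
     simplicial_3complex V E F T \<and> geometric_realization V E F T homeomorphic_space M"

section \<open>PL-metrics\<close>

definition tetrahedron_realizes :: "('v set \<Rightarrow> real) \<Rightarrow> 'v set \<Rightarrow> ('v \<Rightarrow> real^3) \<Rightarrow> bool" where
  "tetrahedron_realizes d \<sigma> p \<longleftrightarrow> (\<forall>u\<in>\<sigma>. \<forall>v\<in>\<sigma>. u \<noteq> v \<longrightarrow> dist (p u) (p v) = d {u, v})"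

text \<open>The realizing tetrahedron may be flat here; flat ones are excluded by nondegeneracy.\<close>

definition PL_metric :: "'v set set \<Rightarrow> 'v set set \<Rightarrow> ('v set \<Rightarrow> real) \<Rightarrow> bool" where
  "PL_metric E T d \<longleftrightarrow>
     (\<forall>e\<in>E. 0 < d e) \<and> (\<forall>\<sigma>\<in>T. \<exists>p. tetrahedron_realizes d \<sigma> p)"

text \<open>The Cayley--Menger determinant, equal to 288 times the squared volume.\<close>

definition cayley_menger :: "('v set \<Rightarrow> real) \<Rightarrow> 'v \<Rightarrow> 'v \<Rightarrow> 'v \<Rightarrow> 'v \<Rightarrow> real" where
  "cayley_menger d i j k l = det (vector
     [vector [0, 1, 1, 1, 1],
      vector [1, 0, (d {i,j})\<^sup>2, (d {i,k})\<^sup>2, (d {i,l})\<^sup>2],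
      vector [1, (d {i,j})\<^sup>2, 0, (d {j,k})\<^sup>2, (d {j,l})\<^sup>2],
      vector [1, (d {i,k})\<^sup>2, (d {j,k})\<^sup>2, 0, (d {k,l})\<^sup>2],
      vector [1, (d {i,l})\<^sup>2, (d {j,l})\<^sup>2, (d {k,l})\<^sup>2, 0]] :: real^5^5)"

definition nondegenerate_PL_metric ::
  "'v set set \<Rightarrow> 'v set set \<Rightarrow> 'v set set \<Rightarrow> ('v set \<Rightarrow> real) \<Rightarrow> bool" where
  "nondegenerate_PL_metric E F T d \<longleftrightarrow>
     PL_metric E T d \<and>
     (\<forall>i j k l. {i,j,k,l} \<in> T \<longrightarrow> 0 < cayley_menger d i j k l) \<and>
     (\<forall>i j k. {i,j,k} \<in> F \<longrightarrow> d {i,j} < d {i,k} + d {k,j})"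

section \<open>Dihedral angles and combinatorial Ricci curvature\<close>

definition orth_component :: "'a::real_inner \<Rightarrow> 'a \<Rightarrow> 'a" where
  "orth_component w v = v - ((v \<bullet> w) / (w \<bullet> w)) *\<^sub>R w"

text \<open>The angle at the line through \<open>a\<close> and \<open>b\<close> between the half-planes containing \<open>x\<close> and \<open>y\<close>.\<close>

definition dihedral_angle_points :: "'a::real_inner \<Rightarrow> 'a \<Rightarrow> 'a \<Rightarrow> 'a \<Rightarrow> real" where
  "dihedral_angle_points a b x y =
     (let u = orth_component (b - a) (x - a); v = orth_component (b - a) (y - a)
      in arccos ((u \<bullet> v) / (norm u * norm v)))"

text \<open>The angle \<open>\<beta>\<^bsub>ij,kl\<^esub>\<close> at the edge \<open>e = {i,j}\<close> of the tetrahedron \<open>\<sigma> = {i,j,k,l}\<close>. If the faces of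
  \<open>\<sigma>\<close> are nondegenerate, it depends neither on the labelling nor on the realizing points.\<close>

definition dihedral_angle :: "('v set \<Rightarrow> real) \<Rightarrow> 'v set \<Rightarrow> 'v set \<Rightarrow> real" where
  "dihedral_angle d e \<sigma> =
     (THE \<beta>. \<exists>p i j k l. e = {i,j} \<and> \<sigma> = {i,j,k,l} \<and> tetrahedron_realizes d \<sigma> p \<and>
        \<beta> = dihedral_angle_points (p i) (p j) (p k) (p l))"

definition edge_curvature :: "'v set set \<Rightarrow> ('v set \<Rightarrow> real) \<Rightarrow> 'v set \<Rightarrow> real" where
  "edge_curvature T d e = 2 * pi - (\<Sum>\<sigma> | \<sigma> \<in> T \<and> e \<subseteq> \<sigma>. dihedral_angle d e \<sigma>)"

section \<open>Metrics and curvatures as vectors\<close>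

text \<open>The edges are numbered by a bijection \<open>\<epsilon>\<close> from a finite index type \<open>'m\<close> onto \<open>E\<close>, so
  \<open>m = CARD('m)\<close>.\<close>

definition edge_length :: "('m \<Rightarrow> 'v set) \<Rightarrow> real^'m \<Rightarrow> 'v set \<Rightarrow> real" where
  "edge_length \<epsilon> l e = l $ (inv \<epsilon> e)"

definition nondegenerate_PL_metrics ::
  "'v set set \<Rightarrow> 'v set set \<Rightarrow> 'v set set \<Rightarrow> ('m \<Rightarrow> 'v set) \<Rightarrow> (real^'m) set" where
  "nondegenerate_PL_metrics E F T \<epsilon> = {l. nondegenerate_PL_metric E F T (edge_length \<epsilon> l)}"

definition ricci_curvature :: "'v set set \<Rightarrow> ('m \<Rightarrow> 'v set) \<Rightarrow> real^'m \<Rightarrow> real^'m" where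
  "ricci_curvature T \<epsilon> l = (\<chi> a. edge_curvature T (edge_length \<epsilon> l) (\<epsilon> a))"

definition discrete_ricci_flat ::
  "'v set set \<Rightarrow> 'v set set \<Rightarrow> 'v set set \<Rightarrow> ('m \<Rightarrow> 'v set) \<Rightarrow> real^'m \<Rightarrow> bool" where
  "discrete_ricci_flat E F T \<epsilon> l \<longleftrightarrow>
     l \<in> nondegenerate_PL_metrics E F T \<epsilon> \<and> ricci_curvature T \<epsilon> l = 0"

end

theory Submission
  imports Defs
begin

text \<open>A limit of a solution of \<open>x' = v(x)\<close> is a zero of \<open>v\<close> as soon as \<open>v\<close> is continuous at this
  limit: if \<open>x(t)\<close> converges, so does its velocity \<open>v(x(t))\<close>, and a convergent function can only
  have the velocity \<open>0\<close> in the limit, because \<open>x(t + 1) - x(t)\<close> tends both to \<open>0\<close> and to the limit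
  velocity (lemma \<open>limit_velocity_eq_0\<close>).

  What has to be shown about the geometry is therefore the continuity of the curvature on the set
  of nondegenerate metrics. The dihedral angle is defined by way of an unspecified realization of
  the tetrahedron in \<open>\<real>\<^sup>3\<close>, and continuity cannot be read off from that. But by polarization all
  inner products of edge vectors are functions of the edge lengths, so the cosine of the dihedral
  angle is an explicit rational expression in the lengths and in the heights of the two faces over
  the common edge (lemma \<open>dihedral_angle_eq_arccos\<close>). By Heron's formula those heights are positive
  when the triangle inequalities are strict, so the cosine is continuous at a nondegenerate metric.
  The function \<open>arccos\<close> is continuous on the closed interval from \<open>-1\<close> to \<open>1\<close>, and realizability keeps
  the cosine inside it, by the Cauchy--Schwarz inequality.\<close>

section \<open>Convergent curves with convergent velocity\<close>

text \<open>Subtracting the linear motion \<open>t *\<^sub>R c\<close> leaves a curve whose velocity tends to \<open>0\<close>, hence whose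
  displacement over a unit of time tends to \<open>0\<close>; but this displacement tends to \<open>-c\<close>.\<close>

lemma limit_velocity_eq_0:
  fixes f :: "real \<Rightarrow> 'b::real_normed_vector"
  assumes deriv: "\<And>t. t \<ge> 0 \<Longrightarrow> (f has_vector_derivative f' t) (at t within {0..})"
    and f: "(f \<longlongrightarrow> L) at_top"
    and f': "(f' \<longlongrightarrow> c) at_top"
  shows "c = 0"
proof -
  have bound: "norm c \<le> e" if "e > 0" for e
  proof -
    have "\<forall>\<^sub>F t in at_top. dist (f' t) c < e"
      using f' \<open>e > 0\<close> by (rule tendstoD)
    then obtain N where N: "\<And>t. t \<ge> N \<Longrightarrow> dist (f' t) c < e"
      by (auto simp: eventually_at_top_linorder)
    have step: "norm ((f (t + 1) - f t) - c) \<le> e" if t: "t \<ge> max 0 N" for t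
    proof -
      have "((\<lambda>s. f s - s *\<^sub>R c) has_derivative (\<lambda>h. h *\<^sub>R (f' s - c))) (at s within {t..t+1})"
        if "s \<in> {t..t+1}" for s
      proof -
        have "(f has_vector_derivative f' s) (at s within {t..t+1})"
          using that t by (intro has_vector_derivative_within_subset[OF deriv]) auto
        then show ?thesis
          unfolding has_vector_derivative_def
          by (auto intro!: derivative_eq_intros simp: algebra_simps)
      qed
      moreover have "onorm (\<lambda>h. h *\<^sub>R (f' s - c)) \<le> e" if "s \<in> {t..t+1}" for s
      proof (rule onorm_le)
        fix h :: real
        have "norm (f' s - c) \<le> e"
          using N[of s] that t by (auto simp: dist_norm)
        then show "norm (h *\<^sub>R (f' s - c)) \<le> e * norm h"
          by (simp add: mult.commute[of e] mult_left_mono)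
      qed
      ultimately have "norm ((f (t+1) - (t+1) *\<^sub>R c) - (f t - t *\<^sub>R c)) \<le> e * norm ((t+1) - t)"
        by (intro differentiable_bound[where S = "{t..t+1}"]) auto
      then show ?thesis
        by (simp add: algebra_simps)
    qed
    have "((\<lambda>t. f (t + 1)) \<longlongrightarrow> L) at_top"
      using filterlim_compose[OF f filterlim_tendsto_add_at_top[OF tendsto_const[of 1] filterlim_ident]]
      by (simp add: add.commute[of _ 1])
    then have "((\<lambda>t. norm ((f (t + 1) - f t) - c)) \<longlongrightarrow> norm ((L - L) - c)) at_top"
      using f by (intro tendsto_norm tendsto_diff tendsto_const)
    moreover have "\<forall>\<^sub>F t in at_top. norm ((f (t + 1) - f t) - c) \<le> e"
      using eventually_ge_at_top step by (rule eventually_mono)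
    ultimately have "norm ((L - L) - c) \<le> e"
      by (intro tendsto_upperbound) auto
    then show ?thesis
      by simp
  qed
  have "norm c \<le> 0"
    by (rule field_le_epsilon) (simp add: bound)
  then show ?thesis
    by simp
qed

section \<open>Dihedral angles in terms of edge lengths\<close>

lemma inner_orth_component:
  "orth_component w u \<bullet> orth_component w v = u \<bullet> v - (u \<bullet> w) * (v \<bullet> w) / (w \<bullet> w)"
  by (cases "w = 0")
    (simp_all add: orth_component_def inner_diff_left inner_diff_right inner_commute)

text \<open>The distance vector from a point to a line does not depend on the base point on the line.\<close>

lemma orth_component_swap:
  "orth_component (a - b) (x - b) = orth_component (b - a) (x - (a::'a::real_inner))"
proof (cases "a = b")
  case False
  have "orth_component (- w) (v - w) = orth_component w v" if "w \<noteq> 0" for v w :: 'a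
    using that
    by (simp add: orth_component_def inner_diff_left diff_divide_distrib scaleR_diff_left)
  from this[of "b - a" "x - a"] False show ?thesis
    by simp
qed simp

lemma dihedral_angle_points_swap_edge:
  "dihedral_angle_points b a x y = dihedral_angle_points a b x y"
  by (simp add: dihedral_angle_points_def orth_component_swap[of a b])

lemma dihedral_angle_points_swap_apexes:
  "dihedral_angle_points a b y x = dihedral_angle_points a b x y"
  by (simp add: dihedral_angle_points_def Let_def inner_commute mult.commute)

text \<open>The inner product of two edge vectors of lengths \<open>a\<close> and \<open>b\<close> whose end points are at
  distance \<open>c\<close>, by the law of cosines.\<close>

definition side_inner :: "real \<Rightarrow> real \<Rightarrow> real \<Rightarrow> real" where
  "side_inner a b c = (a\<^sup>2 + b\<^sup>2 - c\<^sup>2) / 2"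

definition triangle_height :: "real \<Rightarrow> real \<Rightarrow> real \<Rightarrow> real" where
  "triangle_height base a b = sqrt (a\<^sup>2 - (side_inner a base b)\<^sup>2 / base\<^sup>2)"

definition dihedral_cosine :: "('v set \<Rightarrow> real) \<Rightarrow> 'v \<Rightarrow> 'v \<Rightarrow> 'v \<Rightarrow> 'v \<Rightarrow> real" where
  "dihedral_cosine d i j k l =
     (side_inner (d {i,k}) (d {i,l}) (d {k,l})
       - side_inner (d {i,k}) (d {i,j}) (d {j,k}) * side_inner (d {i,l}) (d {i,j}) (d {j,l})
         / (d {i,j})\<^sup>2)
     / (triangle_height (d {i,j}) (d {i,k}) (d {j,k})
        * triangle_height (d {i,j}) (d {i,l}) (d {j,l}))"

lemma inner_eq_side_inner:
  "(x - a) \<bullet> (y - a) = side_inner (dist a x) (dist a y) (dist x (y::'a::real_inner))"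
proof -
  have "norm (x - y) = norm ((x - a) - (y - a))"
    by simp
  then show ?thesis
    unfolding side_inner_def dist_norm
    by (simp add: norm_minus_commute[of a] power2_norm_eq_inner inner_diff_left inner_diff_right
        inner_commute)
qed

lemma norm_orth_component:
  "norm (orth_component (b - a) (x - a))
     = triangle_height (dist a b) (dist a x) (dist b (x::'a::real_inner))"
  unfolding norm_eq_sqrt_inner inner_orth_component triangle_height_def inner_eq_side_inner
  by (simp add: side_inner_def power2_eq_square dist_commute)

text \<open>The expression in the lengths is the quotient of inner product and norms whose \<open>arccos\<close> is the
  angle; the second part is the Cauchy--Schwarz inequality for that quotient. It is needed because
  \<open>arccos\<close> is continuous only on the closed interval from \<open>-1\<close> to \<open>1\<close>, whereas for lengths that
  belong to no tetrahedron the expression can lie outside.\<close>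

lemma tetrahedron_realizes_cosine:
  assumes "card {i,j,k,l} = 4" and "tetrahedron_realizes d {i,j,k,l} p"
  shows "dihedral_angle_points (p i) (p j) (p k) (p l) = arccos (dihedral_cosine d i j k l)"
    and "\<bar>dihedral_cosine d i j k l\<bar> \<le> 1"
proof -
  let ?u = "orth_component (p j - p i) (p k - p i)"
  let ?v = "orth_component (p j - p i) (p l - p i)"
  have neq: "i \<noteq> j" "i \<noteq> k" "i \<noteq> l" "j \<noteq> k" "j \<noteq> l" "k \<noteq> l"
    using assms(1) by (auto simp: card_insert_if split: if_splits)
  have d: "dist (p i) (p j) = d {i,j}" "dist (p i) (p k) = d {i,k}" "dist (p i) (p l) = d {i,l}"
    "dist (p j) (p k) = d {j,k}" "dist (p j) (p l) = d {j,l}" "dist (p k) (p l) = d {k,l}"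
    using assms(2) neq by (auto simp: tetrahedron_realizes_def)
  have eq: "?u \<bullet> ?v / (norm ?u * norm ?v) = dihedral_cosine d i j k l"
    unfolding dihedral_cosine_def norm_orth_component inner_orth_component inner_eq_side_inner
    using d by (simp add: side_inner_def power2_eq_square dist_commute)
  then show "dihedral_angle_points (p i) (p j) (p k) (p l) = arccos (dihedral_cosine d i j k l)"
    by (simp add: dihedral_angle_points_def Let_def)
  have "\<bar>?u \<bullet> ?v / (norm ?u * norm ?v)\<bar> \<le> 1"
    using Cauchy_Schwarz_ineq2[of ?u ?v]
    by (cases "?u = 0 \<or> ?v = 0") (auto simp: divide_le_eq_1)
  then show "\<bar>dihedral_cosine d i j k l\<bar> \<le> 1"
    by (simp add: eq)
qed

text \<open>Any other admissible labelling differs only by exchanging the ends of the edge or the two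
  opposite vertices, and any other realization has the same lengths, so that the description in
  the definition of the dihedral angle determines a single value.\<close>

lemma dihedral_angle_eq_arccos:
  assumes card: "card {i,j,k,l} = 4" and p: "tetrahedron_realizes d {i,j,k,l} p"
  shows "dihedral_angle d {i,j} {i,j,k,l} = arccos (dihedral_cosine d i j k l)"
  unfolding dihedral_angle_def
proof (rule the_equality)
  show "\<exists>p i' j' k' l'. {i,j} = {i',j'} \<and> {i,j,k,l} = {i',j',k',l'} \<and>
      tetrahedron_realizes d {i,j,k,l} p \<and>
      arccos (dihedral_cosine d i j k l) = dihedral_angle_points (p i') (p j') (p k') (p l')"
    using p tetrahedron_realizes_cosine(1)[OF card p] by metis
next
  fix \<beta>
  assume "\<exists>p i' j' k' l'. {i,j} = {i',j'} \<and> {i,j,k,l} = {i',j',k',l'} \<and>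
      tetrahedron_realizes d {i,j,k,l} p \<and>
      \<beta> = dihedral_angle_points (p i') (p j') (p k') (p l')"
  then obtain q i' j' k' l' where e: "{i,j} = {i',j'}" and s: "{i,j,k,l} = {i',j',k',l'}"
    and q: "tetrahedron_realizes d {i,j,k,l} q"
    and \<beta>: "\<beta> = dihedral_angle_points (q i') (q j') (q k') (q l')"
    by blast
  have "i \<noteq> j" "i \<noteq> k" "i \<noteq> l" "j \<noteq> k" "j \<noteq> l" "k \<noteq> l"
    using card by (auto simp: card_insert_if split: if_splits)
  moreover have "{k,l} = {i,j,k,l} - {i,j}"
    using calculation by auto
  moreover have "{k',l'} = {i',j',k',l'} - {i',j'}"
    using card unfolding s by (auto simp: card_insert_if split: if_splits)
  ultimately have o: "{k,l} = {k',l'}"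
    using e s by simp
  have "\<beta> = dihedral_angle_points (q i) (q j) (q k) (q l)"
    using e o unfolding \<beta> doubleton_eq_iff
    by (auto simp: dihedral_angle_points_swap_edge dihedral_angle_points_swap_apexes)
  then show "\<beta> = arccos (dihedral_cosine d i j k l)"
    using tetrahedron_realizes_cosine(1)[OF card q] by simp
qed

section \<open>Continuity of the curvature\<close>

text \<open>Heron's formula: \<open>4\<close> times the squared product of base and height is the product of the sum of
  the sides and the three defects in the triangle inequalities.\<close>

lemma triangle_height_pos:
  assumes "c < a + b" "a < b + c" "b < a + c"
  shows "0 < triangle_height c a b"
proof -
  have pos: "a > 0" "b > 0" "c > 0"
    using assms by linarith+
  have "0 < (a + b + c) * (a + c - b) * ((b + c - a) * (a + b - c))"
    using assms pos by (intro mult_pos_pos) auto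
  also have "\<dots> = 4 * (c\<^sup>2 * (a\<^sup>2 - (side_inner a c b)\<^sup>2 / c\<^sup>2))"
    using pos by (simp add: side_inner_def field_simps power2_eq_square)
  finally show ?thesis
    using pos by (simp add: triangle_height_def zero_less_mult_iff)
qed

lemma tendsto_dihedral_cosine:
  assumes d: "\<And>e. ((\<lambda>t. d t e) \<longlongrightarrow> d' e) F"
    and "d' {i,j} \<noteq> 0"
    and "triangle_height (d' {i,j}) (d' {i,k}) (d' {j,k}) > 0"
    and "triangle_height (d' {i,j}) (d' {i,l}) (d' {j,l}) > 0"
  shows "((\<lambda>t. dihedral_cosine (d t) i j k l) \<longlongrightarrow> dihedral_cosine d' i j k l) F"
  using assms(2-4) unfolding dihedral_cosine_def triangle_height_def side_inner_def
  by (intro tendsto_intros d) auto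

lemma simplicial_3complex_face:
  assumes "simplicial_3complex V E F T" and "s \<in> simplices V E F T" and "card s = 3"
  shows "s \<in> F"
  using assms by (auto simp: simplicial_3complex_def simplices_def)

lemma tendsto_dihedral_angle:
  assumes cpx: "simplicial_3complex V E F T" and T: "\<sigma> \<in> T" and e: "e \<in> E" "e \<subseteq> \<sigma>"
    and d: "\<And>e. ((\<lambda>t. d t e) \<longlongrightarrow> d' e) G"
    and nd: "\<forall>\<^sub>F t in G. nondegenerate_PL_metric E F T (d t)"
    and nd': "nondegenerate_PL_metric E F T d'"
  shows "((\<lambda>t. dihedral_angle (d t) e \<sigma>) \<longlongrightarrow> dihedral_angle d' e \<sigma>) G"
proof -
  have card: "card e = 2" "card \<sigma> = 4"
    using cpx T e by (auto simp: simplicial_3complex_def)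
  then have "card (\<sigma> - e) = 2"
    using e(2) by (simp add: card_Diff_subset card_ge_0_finite)
  with card obtain i j k l where e_eq: "e = {i,j}" and "\<sigma> - e = {k,l}"
    by (metis card_2_iff)
  then have \<sigma>: "\<sigma> = {i,j,k,l}"
    using e by auto
  have neq: "i \<noteq> j" "i \<noteq> k" "i \<noteq> l" "j \<noteq> k" "j \<noteq> l" "k \<noteq> l"
    using card unfolding \<sigma> by (auto simp: card_insert_if split: if_splits)
  have height: "triangle_height (d' {i,j}) (d' {i,x}) (d' {j,x}) > 0" if "x = k \<or> x = l" for x
  proof (rule triangle_height_pos)
    have "\<sigma> \<in> simplices V E F T" "{i,j,x} \<subseteq> \<sigma>"
      using T that by (auto simp: \<sigma> simplices_def)
    then have "{i,j,x} \<in> simplices V E F T"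
      using cpx unfolding simplicial_3complex_def by (metis insert_not_empty)
    then have "{i,j,x} \<in> F"
      using that neq by (intro simplicial_3complex_face[OF cpx]) auto
    moreover have "{i,x,j} = {i,j,x}" "{j,x,i} = {i,j,x}" "{j,i,x} = {i,j,x}"
      by auto
    ultimately have "d' {i,j} < d' {i,x} + d' {x,j}" "d' {i,x} < d' {i,j} + d' {j,x}"
      "d' {j,x} < d' {j,i} + d' {i,x}"
      using nd' unfolding nondegenerate_PL_metric_def by metis+
    then show "d' {i,j} < d' {i,x} + d' {j,x}" "d' {i,x} < d' {j,x} + d' {i,j}"
      "d' {j,x} < d' {i,x} + d' {i,j}"
      by (simp_all add: insert_commute)
  qed
  have "d' {i,j} \<noteq> 0"
    using nd' e e_eq by (force simp: nondegenerate_PL_metric_def PL_metric_def)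
  with d height have cosine:
    "((\<lambda>t. dihedral_cosine (d t) i j k l) \<longlongrightarrow> dihedral_cosine d' i j k l) G"
    by (intro tendsto_dihedral_cosine) auto
  have realized: "dihedral_angle h e \<sigma> = arccos (dihedral_cosine h i j k l) \<and>
      dihedral_cosine h i j k l \<in> {-1..1}" if h: "nondegenerate_PL_metric E F T h" for h
  proof -
    obtain p where "tetrahedron_realizes h \<sigma> p"
      using h T by (auto simp: nondegenerate_PL_metric_def PL_metric_def)
    with card show ?thesis
      using dihedral_angle_eq_arccos[of i j k l h p] tetrahedron_realizes_cosine(2)[of i j k l h p]
      unfolding \<sigma> e_eq by (auto simp: abs_le_iff)
  qed
  have "((\<lambda>t. arccos (dihedral_cosine (d t) i j k l)) \<longlongrightarrow> arccos (dihedral_cosine d' i j k l)) G"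
    using realized nd' eventually_mono[OF nd, of "\<lambda>t. dihedral_cosine (d t) i j k l \<in> {-1..1}"]
    by (intro continuous_on_tendsto_compose[OF continuous_on_arccos' cosine]) auto
  moreover have
    "\<forall>\<^sub>F t in G. arccos (dihedral_cosine (d t) i j k l) = dihedral_angle (d t) e \<sigma>"
    using nd by eventually_elim (simp add: realized)
  ultimately show ?thesis
    using realized[OF nd'] by (simp add: tendsto_cong)
qed

lemma tendsto_ricci_curvature:
  assumes cpx: "simplicial_3complex V E F T" and \<epsilon>: "range \<epsilon> \<subseteq> E"
    and l: "(l \<longlongrightarrow> l') G"
    and nd: "\<forall>\<^sub>F t in G. l t \<in> nondegenerate_PL_metrics E F T \<epsilon>"
    and nd': "l' \<in> nondegenerate_PL_metrics E F T \<epsilon>"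
  shows "((\<lambda>t. ricci_curvature T \<epsilon> (l t)) \<longlongrightarrow> ricci_curvature T \<epsilon> l') G"
proof -
  have len: "((\<lambda>t. edge_length \<epsilon> (l t) e) \<longlongrightarrow> edge_length \<epsilon> l' e) G" for e
    unfolding edge_length_def by (intro tendsto_intros l)
  show ?thesis
    unfolding ricci_curvature_def edge_curvature_def
    using nd nd' \<epsilon> unfolding nondegenerate_PL_metrics_def
    by (intro tendsto_intros tendsto_dihedral_angle[OF cpx _ _ _ len]) auto
qed

section \<open>Limits of the flow\<close>

theorem theorem2p1:
  fixes M :: "'a topology"
    and V :: "'v set" and E F T :: "'v set set"
    and \<epsilon> :: "'m::finite \<Rightarrow> 'v set"
    and l :: "real \<Rightarrow> real^'m" and l_inf :: "real^'m"
  assumes "compact_3manifold M"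
    and "triangulation_of M V E F T"
    and "bij_betw \<epsilon> UNIV E"
    and "\<forall>t\<ge>0. l t \<in> nondegenerate_PL_metrics E F T \<epsilon>"
    and "\<forall>t\<ge>0. (l has_vector_derivative - ricci_curvature T \<epsilon> (l t)) (at t within {0..})"
    and "(l \<longlongrightarrow> l_inf) at_top"
    and "l_inf \<in> nondegenerate_PL_metrics E F T \<epsilon>"
  shows "(\<exists>l'. discrete_ricci_flat E F T \<epsilon> l') \<and> discrete_ricci_flat E F T \<epsilon> l_inf"
proof -
  have "\<forall>\<^sub>F t in at_top. l t \<in> nondegenerate_PL_metrics E F T \<epsilon>"
    using assms(4) by (auto simp: eventually_at_top_linorder)
  moreover have "simplicial_3complex V E F T" "range \<epsilon> \<subseteq> E"
    using assms(2,3) by (auto simp: triangulation_of_def bij_betw_def)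
  ultimately have "((\<lambda>t. ricci_curvature T \<epsilon> (l t)) \<longlongrightarrow> ricci_curvature T \<epsilon> l_inf) at_top"
    using assms(6,7) by (intro tendsto_ricci_curvature)
  then have "((\<lambda>t. - ricci_curvature T \<epsilon> (l t)) \<longlongrightarrow> - ricci_curvature T \<epsilon> l_inf) at_top"
    by (rule tendsto_minus)
  then have "- ricci_curvature T \<epsilon> l_inf = 0"
    using assms(5,6) by (intro limit_velocity_eq_0[of l]) auto
  then have "discrete_ricci_flat E F T \<epsilon> l_inf"
    using assms(7) by (simp add: discrete_ricci_flat_def)
  then show ?thesis
    by blast
qed

end
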